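(* Let $(E_1,d_1)$ and $(E_2,d_2)$ be Polish spaces with Borel $\sigma$-algebras $\mathcal{E}_1,\mathcal{E}_2$, and let $(X_n)$ and $(Y_n)$ be sequences of random elements of $E_1$ and $E_2$ respectively, all defined on one probability space. Suppose that the sequences of distributions $(P_{X_n})$ and $(P_{Y_n})$ are tight. Then the following implications hold for $(X_n),(Y_n)$: $$\text{AI-4}\Rightarrow\text{AI-3}\Rightarrow\text{AI-2}\Rightarrow\text{AI-1}\Rightarrow\text{AI-0}.$$ Moreover, in this case $\text{AI-0}\Rightarrow\text{AI-1}$.
   Context: $d_1,d_2$ are complete separable metrics, and $E_1\times E_2$ carries the metric $d((x_1,y_1),(x_2,y_2))=d_1(x_1,x_2)+d_2(y_1,y_2)$ (or, equivalently, the maximum metric). $P_\xi$ denotes the distribution of a random element $\xi$; $(X_n,Y_n)$ is regarded as a random element of $(E_1\times E_2,\mathcal{E}_1\times\mathcal{E}_2)$. All limits are as $n\to+\infty$. AI-0: for all bounded uniformly continuous $f:E_1\to\mathbb{R}$, $g:E_2\to\mathbb{R}$, $\mathbb{E}f(X_n)g(Y_n)-\mathbb{E}f(X_n)\,\mathbb{E}g(Y_n)\to 0$. AI-1: for all bounded uniformly continuous $h:E_1\times E_2\to\mathbb{R}$, $\int h\,dP_{(X_n,Y_n)}-\int h\,d(P_{X_n}\times P_{Y_n})\to 0$. AI-2: for all $A\in\mathcal{E}_1$, $B\in\mathcal{E}_2$, $|P_{(X_n,Y_n)}(A\times B)-P_{X_n}(A)P_{Y_n}(B)|\to 0$. AI-3: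 $\sup_{A\in\mathcal{E}_1,B\in\mathcal{E}_2}|P_{(X_n,Y_n)}(A\times B)-P_{X_n}(A)P_{Y_n}(B)|\to 0$. AI-4: $\|P_{(X_n,Y_n)}-P_{X_n}\times P_{Y_n}\|_{var}\to 0$, where $\|\cdot\|_{var}$ is the total variation norm. *)

theory Defs
  imports "HOL-Probability.Probability"
begin

text \<open>
  The library metric on \<^typ>\<open>'a \<times> 'b\<close> is the Euclidean combination of the two component
  metrics, whereas here the product carries their sum. Uniform continuity is therefore spelled
  out for the sum metric; the two notions agree by the lemma below.
\<close>

definition sum_dist :: "'a::metric_space \<times> 'b::metric_space \<Rightarrow> 'a \<times> 'b \<Rightarrow> real" where
  "sum_dist p q = dist (fst p) (fst q) + dist (snd p) (snd q)"

definition uniformly_continuous_sum :: "('a::metric_space \<times> 'b::metric_space \<Rightarrow> real) \<Rightarrow> bool" where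
  "uniformly_continuous_sum h \<longleftrightarrow>
     (\<forall>e>0. \<exists>\<delta>>0. \<forall>p q. sum_dist p q < \<delta> \<longrightarrow> \<bar>h p - h q\<bar> < e)"

lemma dist_le_sum_dist: "dist p q \<le> sum_dist p q"
  unfolding sum_dist_def dist_prod_def
  by (rule sqrt_sum_squares_le_sum) auto

lemma sum_dist_le_dist: "sum_dist p q \<le> 2 * dist p q"
  using dist_fst_le[of p q] dist_snd_le[of p q] unfolding sum_dist_def by linarith

lemma uniformly_continuous_sum_iff:
  "uniformly_continuous_sum h \<longleftrightarrow> uniformly_continuous_on UNIV h"
proof
  assume h: "uniformly_continuous_sum h"
  show "uniformly_continuous_on UNIV h"
    unfolding uniformly_continuous_on_def
  proof (intro allI impI)
    fix e :: real assume "e > 0"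
    with h obtain \<delta> where \<delta>: "\<delta> > 0" "\<And>p q. sum_dist p q < \<delta> \<Longrightarrow> \<bar>h p - h q\<bar> < e"
      unfolding uniformly_continuous_sum_def by blast
    have "dist (h q) (h p) < e" if "dist q p < \<delta> / 2" for p q
      unfolding dist_real_def using that sum_dist_le_dist[of q p] by (intro \<delta>(2)) linarith
    with \<delta>(1) show "\<exists>d>0. \<forall>x\<in>UNIV. \<forall>x'\<in>UNIV. dist x' x < d \<longrightarrow> dist (h x') (h x) < e"
      by (intro exI[of _ "\<delta> / 2"]) auto
  qed
next
  assume h: "uniformly_continuous_on UNIV h"
  show "uniformly_continuous_sum h"
    unfolding uniformly_continuous_sum_def
  proof (intro allI impI)
    fix e :: real assume "e > 0"
    with h obtain \<delta> where \<delta>: "\<delta> > 0" "\<And>p q. dist q p < \<delta> \<Longrightarrow> dist (h q) (h p) < e"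
      unfolding uniformly_continuous_on_def by blast
    have "\<bar>h q - h p\<bar> < e" if "sum_dist q p < \<delta>" for p q
      using that dist_le_sum_dist[of q p] \<delta>(2)[of q p] by (simp add: dist_real_def)
    with \<delta>(1) show "\<exists>\<delta>>0. \<forall>p q. sum_dist p q < \<delta> \<longrightarrow> \<bar>h p - h q\<bar> < e"
      by blast
  qed
qed

definition tight_measures :: "(nat \<Rightarrow> 'a::topological_space measure) \<Rightarrow> bool" where
  "tight_measures \<mu> \<longleftrightarrow> (\<forall>e>0. \<exists>K. compact K \<and> (\<forall>n. measure (\<mu> n) (- K) < e))"

text \<open>
  Total variation norm of the signed measure \<open>\<mu> - \<nu>\<close>, i.e. its total mass
  \<open>\<bar>\<mu> - \<nu>\<bar>(\<Omega>)\<close>, for finite measures on the same measurable space. The supremum is a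
  real one; it is taken over a bounded set by the lemma that follows.
\<close>

definition tv_norm_diff :: "'a measure \<Rightarrow> 'a measure \<Rightarrow> real" where
  "tv_norm_diff \<mu> \<nu> =
     (SUP P \<in> {P. finite P \<and> P \<subseteq> sets \<mu> \<and> partition_on (space \<mu>) P}.
        \<Sum>A\<in>P. \<bar>measure \<mu> A - measure \<nu> A\<bar>)"

lemma tv_norm_diff_bdd_above:
  assumes "finite_measure \<mu>" "finite_measure \<nu>" "sets \<mu> = sets \<nu>"
  shows "bdd_above ((\<lambda>P. \<Sum>A\<in>P. \<bar>measure \<mu> A - measure \<nu> A\<bar>) `
           {P. finite P \<and> P \<subseteq> sets \<mu> \<and> partition_on (space \<mu>) P})"
proof (rule bdd_aboveI2)
  fix P assume "P \<in> {P. finite P \<and> P \<subseteq> sets \<mu> \<and> partition_on (space \<mu>) P}"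
  then have P: "finite P" "P \<subseteq> sets \<mu>" "disjoint P" "\<Union>P = space \<mu>"
    by (auto simp: partition_on_def)
  have "disjoint_family_on id P"
    using P(3) by (auto simp: disjoint_family_on_def disjoint_def)
  then have "(\<Sum>A\<in>P. measure \<rho> A) = measure \<rho> (space \<mu>)"
    if "finite_measure \<rho>" "sets \<rho> = sets \<mu>" for \<rho>
    using finite_measure.finite_measure_finite_Union[OF that(1) P(1), of id] P that(2) by auto
  then have "(\<Sum>A\<in>P. measure \<mu> A + measure \<nu> A) = measure \<mu> (space \<mu>) + measure \<nu> (space \<mu>)"
    using assms by (simp add: sum.distrib)
  moreover have "(\<Sum>A\<in>P. \<bar>measure \<mu> A - measure \<nu> A\<bar>) \<le> (\<Sum>A\<in>P. measure \<mu> A + measure \<nu> A)"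
    by (intro sum_mono) (simp add: abs_le_iff)
  ultimately show "(\<Sum>A\<in>P. \<bar>measure \<mu> A - measure \<nu> A\<bar>) \<le> measure \<mu> (space \<mu>) + measure \<nu> (space \<mu>)"
    by simp
qed

definition AI0 ::
  "'c measure \<Rightarrow> (nat \<Rightarrow> 'c \<Rightarrow> 'a::polish_space) \<Rightarrow> (nat \<Rightarrow> 'c \<Rightarrow> 'b::polish_space) \<Rightarrow> bool" where
  "AI0 M X Y \<longleftrightarrow>
     (\<forall>(f :: 'a \<Rightarrow> real) (g :: 'b \<Rightarrow> real).
        bounded (range f) \<and> uniformly_continuous_on UNIV f \<and>
        bounded (range g) \<and> uniformly_continuous_on UNIV g \<longrightarrow>
        (\<lambda>n. (LINT \<omega>|M. f (X n \<omega>) * g (Y n \<omega>))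
              - (LINT \<omega>|M. f (X n \<omega>)) * (LINT \<omega>|M. g (Y n \<omega>))) \<longlonglongrightarrow> 0)"

definition joint_distr ::
  "'c measure \<Rightarrow> ('c \<Rightarrow> 'a::polish_space) \<Rightarrow> ('c \<Rightarrow> 'b::polish_space) \<Rightarrow> ('a \<times> 'b) measure" where
  "joint_distr M \<xi> \<eta> = distr M (borel \<Otimes>\<^sub>M borel) (\<lambda>\<omega>. (\<xi> \<omega>, \<eta> \<omega>))"

definition prod_distr ::
  "'c measure \<Rightarrow> ('c \<Rightarrow> 'a::polish_space) \<Rightarrow> ('c \<Rightarrow> 'b::polish_space) \<Rightarrow> ('a \<times> 'b) measure" where
  "prod_distr M \<xi> \<eta> = distr M borel \<xi> \<Otimes>\<^sub>M distr M borel \<eta>"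

definition AI1 ::
  "'c measure \<Rightarrow> (nat \<Rightarrow> 'c \<Rightarrow> 'a::polish_space) \<Rightarrow> (nat \<Rightarrow> 'c \<Rightarrow> 'b::polish_space) \<Rightarrow> bool" where
  "AI1 M X Y \<longleftrightarrow>
     (\<forall>h :: 'a \<times> 'b \<Rightarrow> real. bounded (range h) \<and> uniformly_continuous_sum h \<longrightarrow>
        (\<lambda>n. (LINT z|joint_distr M (X n) (Y n). h z)
              - (LINT z|prod_distr M (X n) (Y n). h z)) \<longlonglongrightarrow> 0)"

definition AI_gap ::
  "'c measure \<Rightarrow> ('c \<Rightarrow> 'a::polish_space) \<Rightarrow> ('c \<Rightarrow> 'b::polish_space) \<Rightarrow> 'a set \<Rightarrow> 'b set \<Rightarrow> real" where
  "AI_gap M \<xi> \<eta> A B =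
     \<bar>measure (joint_distr M \<xi> \<eta>) (A \<times> B) - measure (distr M borel \<xi>) A * measure (distr M borel \<eta>) B\<bar>"

definition AI2 ::
  "'c measure \<Rightarrow> (nat \<Rightarrow> 'c \<Rightarrow> 'a::polish_space) \<Rightarrow> (nat \<Rightarrow> 'c \<Rightarrow> 'b::polish_space) \<Rightarrow> bool" where
  "AI2 M X Y \<longleftrightarrow>
     (\<forall>A \<in> sets borel. \<forall>B \<in> sets borel. (\<lambda>n. AI_gap M (X n) (Y n) A B) \<longlonglongrightarrow> 0)"

text \<open>For random elements on a probability space every \<^term>\<open>AI_gap M \<xi> \<eta> A B\<close> lies in
  \<open>[0, 1]\<close>, so the real supremum below is over a bounded nonempty set.\<close>

definition AI3 ::
  "'c measure \<Rightarrow> (nat \<Rightarrow> 'c \<Rightarrow> 'a::polish_space) \<Rightarrow> (nat \<Rightarrow> 'c \<Rightarrow> 'b::polish_space) \<Rightarrow> bool" where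
  "AI3 M X Y \<longleftrightarrow>
     (\<lambda>n. SUP (A, B) \<in> sets borel \<times> sets borel. AI_gap M (X n) (Y n) A B) \<longlonglongrightarrow> 0"

definition AI4 ::
  "'c measure \<Rightarrow> (nat \<Rightarrow> 'c \<Rightarrow> 'a::polish_space) \<Rightarrow> (nat \<Rightarrow> 'c \<Rightarrow> 'b::polish_space) \<Rightarrow> bool" where
  "AI4 M X Y \<longleftrightarrow>
     (\<lambda>n. tv_norm_diff (joint_distr M (X n) (Y n)) (prod_distr M (X n) (Y n))) \<longlonglongrightarrow> 0"

end

theory Submission
  imports Defs
begin

text \<open>
  The implications AI-4 \<open>\<Rightarrow>\<close> AI-3 \<open>\<Rightarrow>\<close> AI-2 hold because the gap over a rectangle is bounded by the
  total variation distance (\<open>measure_diff_le_tv_norm_diff\<close>) and by the supremum over all rectangles,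
  and AI-1 \<open>\<Rightarrow>\<close> AI-0 because \<open>(x, y) \<mapsto> f x * g y\<close> is bounded and uniformly continuous whenever
  \<open>f\<close> and \<open>g\<close> are.

  The content lies in AI-2 \<open>\<Rightarrow>\<close> AI-1 and AI-0 \<open>\<Rightarrow>\<close> AI-1, which are proved by one argument
  (\<open>AI1_if_covariance_tendsto_0\<close>). By tightness there are compact sets \<open>K\<close> and \<open>L\<close> whose complements
  have small probability under all marginals. Cover them by finitely many small balls with centres
  \<open>C\<close> and \<open>D\<close>, and take nonnegative weights \<open>p\<^sub>c\<close> and \<open>q\<^sub>d\<close> supported near the centres, with sum at most 1
  everywhere and equal to 1 on \<open>K\<close> and \<open>L\<close>. Then \<open>H (x, y) = (\<Sum>c\<in>C. \<Sum>d\<in>D. h (c, d) * p\<^sub>c x * q\<^sub>d y)\<close>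
  is uniformly close to \<open>h\<close> on \<open>K \<times> L\<close> and bounded by \<open>sup \<bar>h\<bar>\<close> elsewhere, so the integrals of \<open>h\<close>
  and \<open>H\<close> are close under both the joint law and the product of the marginals, uniformly in \<open>n\<close>.
  The two integrals of \<open>H\<close> differ by a fixed linear combination of the covariances of \<open>p\<^sub>c (X n)\<close> and
  \<open>q\<^sub>d (Y n)\<close>. The weights may be chosen as indicators of Borel sets, whose covariances vanish under
  AI-2, or as uniformly continuous functions, whose covariances vanish under AI-0; both families
  are instances of \<open>bump_class\<close>, which is all that the construction of the weights needs.
\<close>

section \<open>Weights subordinate to a finite cover by balls\<close>

text \<open>
  A family of Borel functions into \<open>[0, 1]\<close> that contains a bump function for every ball and is
  closed under \<open>f * (1 - g)\<close>; for indicators the latter is the difference of sets.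
\<close>

definition bump_class :: "('a::metric_space \<Rightarrow> real) set \<Rightarrow> bool" where
  "bump_class F \<longleftrightarrow>
     (\<forall>f\<in>F. f \<in> borel_measurable borel \<and> (\<forall>x. 0 \<le> f x \<and> f x \<le> 1)) \<and>
     (\<forall>f\<in>F. \<forall>g\<in>F. (\<lambda>x. f x * (1 - g x)) \<in> F) \<and>
     (\<forall>c. \<forall>\<delta>>0. \<exists>f\<in>F. (\<forall>x. dist c x < \<delta> \<longrightarrow> f x = 1) \<and> (\<forall>x. f x \<noteq> 0 \<longrightarrow> dist c x < 2 * \<delta>))"

lemma bump_classI:
  assumes "\<And>f. f \<in> F \<Longrightarrow> f \<in> borel_measurable borel"
    and "\<And>f x. f \<in> F \<Longrightarrow> 0 \<le> f x" "\<And>f x. f \<in> F \<Longrightarrow> f x \<le> 1"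
    and "\<And>f g. f \<in> F \<Longrightarrow> g \<in> F \<Longrightarrow> (\<lambda>x. f x * (1 - g x)) \<in> F"
    and "\<And>c \<delta>. 0 < \<delta> \<Longrightarrow>
      \<exists>f\<in>F. (\<forall>x. dist c x < \<delta> \<longrightarrow> f x = 1) \<and> (\<forall>x. f x \<noteq> 0 \<longrightarrow> dist c x < 2 * \<delta>)"
  shows "bump_class F"
  unfolding bump_class_def by (intro conjI ballI allI impI assms)

lemma
  assumes "bump_class F"
  shows bump_class_measurable: "f \<in> F \<Longrightarrow> f \<in> borel_measurable borel"
    and bump_class_nonneg: "f \<in> F \<Longrightarrow> 0 \<le> f x"
    and bump_class_le_1: "f \<in> F \<Longrightarrow> f x \<le> 1"
    and bump_class_mult_compl: "f \<in> F \<Longrightarrow> g \<in> F \<Longrightarrow> (\<lambda>x. f x * (1 - g x)) \<in> F"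
  using assms unfolding bump_class_def by simp_all

lemma bump_class_obtains_bump:
  assumes "bump_class F" "0 < \<delta>"
  obtains f where "f \<in> F" "\<And>x. dist c x < \<delta> \<Longrightarrow> f x = 1" "\<And>x. f x \<noteq> 0 \<Longrightarrow> dist c x < 2 * \<delta>"
proof -
  have "\<exists>f\<in>F. (\<forall>x. dist c x < \<delta> \<longrightarrow> f x = 1) \<and> (\<forall>x. f x \<noteq> 0 \<longrightarrow> dist c x < 2 * \<delta>)"
    using assms by (simp add: bump_class_def)
  then show thesis using that by auto
qed

text \<open>
  If \<open>p\<close> is a system of weights for the centres \<open>C\<close> and \<open>\<phi>\<close> a bump at a new centre, then \<open>p\<^sub>c * (1 - \<phi>)\<close>
  together with \<open>\<phi>\<close> is one for the enlarged set: its sum is \<open>1 - (1 - \<phi>) * (1 - (\<Sum>c\<in>C. p\<^sub>c))\<close>, so no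
  normalising quotient is needed.
\<close>

lemma bump_class_weights:
  fixes F :: "('a::metric_space \<Rightarrow> real) set"
  assumes F: "bump_class F" and \<delta>: "0 < \<delta>" and "finite C"
  obtains p where
    "\<And>c. c \<in> C \<Longrightarrow> p c \<in> F"
    "\<And>x. (\<Sum>c\<in>C. p c x) \<le> 1"
    "\<And>x. x \<in> (\<Union>c\<in>C. ball c \<delta>) \<Longrightarrow> (\<Sum>c\<in>C. p c x) = 1"
    "\<And>c x. c \<in> C \<Longrightarrow> p c x \<noteq> 0 \<Longrightarrow> dist c x < 2 * \<delta>"
proof -
  have "\<exists>p. (\<forall>c\<in>C. p c \<in> F) \<and> (\<forall>x. (\<Sum>c\<in>C. p c x) \<le> 1) \<and>
      (\<forall>x\<in>(\<Union>c\<in>C. ball c \<delta>). (\<Sum>c\<in>C. p c x) = 1) \<and>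
      (\<forall>c\<in>C. \<forall>x. p c x \<noteq> 0 \<longrightarrow> dist c x < 2 * \<delta>)"
    using \<open>finite C\<close>
  proof (induction C rule: finite_induct)
    case empty
    then show ?case by simp
  next
    case (insert a C)
    from insert.IH obtain p where "\<forall>c\<in>C. p c \<in> F" "\<forall>x. (\<Sum>c\<in>C. p c x) \<le> 1"
      "\<forall>x\<in>(\<Union>c\<in>C. ball c \<delta>). (\<Sum>c\<in>C. p c x) = 1"
      "\<forall>c\<in>C. \<forall>x. p c x \<noteq> 0 \<longrightarrow> dist c x < 2 * \<delta>"
      by (elim exE conjE)
    note p = this[rule_format]
    obtain \<phi> where \<phi>: "\<phi> \<in> F" "\<And>x. dist a x < \<delta> \<Longrightarrow> \<phi> x = 1"
        "\<And>x. \<phi> x \<noteq> 0 \<Longrightarrow> dist a x < 2 * \<delta>"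
      using bump_class_obtains_bump[OF F \<delta>, of a] by metis
    have \<phi>01: "0 \<le> \<phi> x" "\<phi> x \<le> 1" for x
      using bump_class_nonneg[OF F \<phi>(1)] bump_class_le_1[OF F \<phi>(1)] .
    define q where "q = (\<lambda>c x. if c = a then \<phi> x else p c x * (1 - \<phi> x))"
    have q_F: "q c \<in> F" if "c \<in> insert a C" for c
    proof (cases "c = a")
      case True
      then show ?thesis using \<phi>(1) by (simp add: q_def)
    next
      case False
      with that have "p c \<in> F" using p(1) by simp
      then have "(\<lambda>x. p c x * (1 - \<phi> x)) \<in> F"
        using bump_class_mult_compl[OF F _ \<phi>(1)] by blast
      then show ?thesis using False by (simp add: q_def)
    qed
    have q_sum: "(\<Sum>c\<in>insert a C. q c x) = \<phi> x + (1 - \<phi> x) * (\<Sum>c\<in>C. p c x)" for x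
    proof -
      have "(\<Sum>c\<in>C. q c x) = (\<Sum>c\<in>C. (1 - \<phi> x) * p c x)"
        using insert.hyps by (intro sum.cong) (auto simp: q_def)
      then show ?thesis
        using insert.hyps by (simp add: q_def sum_distrib_left)
    qed
    have q_le: "(\<Sum>c\<in>insert a C. q c x) \<le> 1" for x
      using mult_left_mono[OF p(2)[of x], of "1 - \<phi> x"] \<phi>01(2)[of x] unfolding q_sum by simp
    have q_eq: "(\<Sum>c\<in>insert a C. q c x) = 1" if "x \<in> (\<Union>c\<in>insert a C. ball c \<delta>)" for x
    proof -
      from that consider "dist a x < \<delta>" | "x \<in> (\<Union>c\<in>C. ball c \<delta>)" by auto
      then show ?thesis
      proof cases
        case 1
        then show ?thesis by (simp add: q_sum \<phi>(2))
      next
        case 2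
        from p(3)[OF 2] show ?thesis by (simp add: q_sum)
      qed
    qed
    have q_supp: "dist c x < 2 * \<delta>" if "c \<in> insert a C" "q c x \<noteq> 0" for c x
      using that \<phi>(3)[of x] p(4)[of c x] by (auto simp: q_def split: if_splits)
    show ?case
      by (intro exI[of _ q] conjI ballI allI impI q_F q_le q_eq q_supp)
  qed
  then obtain p where "\<forall>c\<in>C. p c \<in> F" "\<forall>x. (\<Sum>c\<in>C. p c x) \<le> 1"
    "\<forall>x\<in>(\<Union>c\<in>C. ball c \<delta>). (\<Sum>c\<in>C. p c x) = 1"
    "\<forall>c\<in>C. \<forall>x. p c x \<noteq> 0 \<longrightarrow> dist c x < 2 * \<delta>"
    by (elim exE conjE)
  note p = this[rule_format]
  show thesis by (rule that[of p]) (fact p)+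
qed

lemma bump_class_indicator: "bump_class {indicator A :: 'a::metric_space \<Rightarrow> real | A. A \<in> sets borel}"
  (is "bump_class ?F")
proof (rule bump_classI)
  show "\<exists>f\<in>?F. (\<forall>x. dist c x < \<delta> \<longrightarrow> f x = 1) \<and> (\<forall>x. f x \<noteq> 0 \<longrightarrow> dist c x < 2 * \<delta>)"
    if "0 < \<delta>" for c :: 'a and \<delta>
  proof (intro bexI[of _ "indicator (ball c \<delta>)"])
    show "(\<forall>x. dist c x < \<delta> \<longrightarrow> indicator (ball c \<delta>) x = (1::real)) \<and>
        (\<forall>x. indicator (ball c \<delta>) x \<noteq> (0::real) \<longrightarrow> dist c x < 2 * \<delta>)"
      using that by (auto simp: indicator_def)
  qed (use open_ball borel_open in blast)
  show "(\<lambda>x. f x * (1 - g x)) \<in> ?F" if "f \<in> ?F" "g \<in> ?F" for f g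
  proof -
    from that obtain A B where AB: "f = indicator A" "A \<in> sets borel" "g = indicator B" "B \<in> sets borel"
      by auto
    have "(\<lambda>x. f x * (1 - g x)) = indicator (A - B)"
      by (simp add: AB indicator_def fun_eq_iff)
    moreover have "A - B \<in> sets borel" using AB by auto
    ultimately show ?thesis by auto
  qed
  show "f \<in> borel_measurable borel" "0 \<le> f x" "f x \<le> 1" if "f \<in> ?F" for f x
    using that by auto
qed

lemma uniformly_continuous_on_Pair_metric:
  fixes f :: "'a::metric_space \<Rightarrow> 'b::metric_space" and g :: "'a \<Rightarrow> 'c::metric_space"
  assumes "uniformly_continuous_on S f" "uniformly_continuous_on S g"
  shows "uniformly_continuous_on S (\<lambda>x. (f x, g x))"
  unfolding uniformly_continuous_on_def
proof (intro allI impI)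
  fix e :: real assume "0 < e"
  then have "0 < e / 2" by simp
  with assms obtain d1 d2 where d: "0 < d1" "0 < d2"
    "\<And>x x'. x \<in> S \<Longrightarrow> x' \<in> S \<Longrightarrow> dist x' x < d1 \<Longrightarrow> dist (f x') (f x) < e / 2"
    "\<And>x x'. x \<in> S \<Longrightarrow> x' \<in> S \<Longrightarrow> dist x' x < d2 \<Longrightarrow> dist (g x') (g x) < e / 2"
    unfolding uniformly_continuous_on_def by metis
  have "dist (f x', g x') (f x, g x) < e"
    if "x \<in> S" "x' \<in> S" "dist x' x < min d1 d2" for x x'
    using d(3)[of x x'] d(4)[of x x'] dist_le_sum_dist[of "(f x', g x')" "(f x, g x)"] that
    by (simp add: sum_dist_def)
  then show "\<exists>d>0. \<forall>x\<in>S. \<forall>x'\<in>S. dist x' x < d \<longrightarrow> dist (f x', g x') (f x, g x) < e"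
    using d(1,2) by (intro exI[of _ "min d1 d2"]) auto
qed

lemma uniformly_continuous_on_mult_bounded:
  fixes f g :: "'a::metric_space \<Rightarrow> real"
  assumes "uniformly_continuous_on S f" "uniformly_continuous_on S g"
    and "bounded (f ` S)" "bounded (g ` S)"
  shows "uniformly_continuous_on S (\<lambda>x. f x * g x)"
proof -
  have "compact (closure (f ` S) \<times> closure (g ` S))"
    using assms by (intro compact_Times) auto
  then have "uniformly_continuous_on (closure (f ` S) \<times> closure (g ` S)) (\<lambda>z. fst z * snd z)"
    by (intro compact_uniformly_continuous continuous_intros)
  moreover have "(\<lambda>x. (f x, g x)) ` S \<subseteq> closure (f ` S) \<times> closure (g ` S)"
    using closure_subset[of "f ` S"] closure_subset[of "g ` S"] by auto
  ultimately have "uniformly_continuous_on ((\<lambda>x. (f x, g x)) ` S) (\<lambda>z. fst z * snd z)"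
    unfolding uniformly_continuous_on_def by (meson subsetD)
  with uniformly_continuous_on_Pair_metric[OF assms(1,2)]
  show ?thesis
    using uniformly_continuous_on_compose[of S "\<lambda>x. (f x, g x)" "\<lambda>z. fst z * snd z"] by simp
qed

lemma bounded_range_unit_interval:
  fixes f :: "'a \<Rightarrow> real"
  assumes "\<And>x. 0 \<le> f x" "\<And>x. f x \<le> 1"
  shows "bounded (range f)"
  using assms by (intro boundedI[of _ 1]) auto

lemma bump_class_uniformly_continuous:
  "bump_class {f :: 'a::metric_space \<Rightarrow> real. uniformly_continuous_on UNIV f \<and> (\<forall>x. 0 \<le> f x \<and> f x \<le> 1)}"
  (is "bump_class ?F")
proof (rule bump_classI)
  show "\<exists>f\<in>?F. (\<forall>x. dist c x < \<delta> \<longrightarrow> f x = 1) \<and> (\<forall>x. f x \<noteq> 0 \<longrightarrow> dist c x < 2 * \<delta>)"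
    if \<delta>: "0 < \<delta>" for c :: 'a and \<delta>
  proof (intro bexI[of _ "\<lambda>x. max 0 (min 1 (2 - dist c x / \<delta>))"])
    have "(1/\<delta>)-lipschitz_on UNIV (\<lambda>x. max 0 (min 1 (2 - dist c x / \<delta>)))"
    proof (rule lipschitz_onI)
      fix x y :: 'a
      have "\<bar>dist c x - dist c y\<bar> \<le> dist x y"
        by (metis abs_dist_diff_le dist_commute)
      then have "\<bar>dist c x / \<delta> - dist c y / \<delta>\<bar> \<le> 1 / \<delta> * dist x y"
        using \<delta> by (simp add: diff_divide_distrib[symmetric] divide_right_mono)
      then show "dist (max 0 (min 1 (2 - dist c x / \<delta>))) (max 0 (min 1 (2 - dist c y / \<delta>)))
          \<le> 1 / \<delta> * dist x y"
        unfolding dist_real_def by linarith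
    qed (use \<delta> in simp)
    then show "(\<lambda>x. max 0 (min 1 (2 - dist c x / \<delta>))) \<in> ?F"
      by (auto dest: lipschitz_on_uniformly_continuous)
    show "(\<forall>x. dist c x < \<delta> \<longrightarrow> max 0 (min 1 (2 - dist c x / \<delta>)) = 1) \<and>
        (\<forall>x. max 0 (min 1 (2 - dist c x / \<delta>)) \<noteq> 0 \<longrightarrow> dist c x < 2 * \<delta>)"
      using \<delta> by (auto simp: max_def min_def field_simps split: if_splits)
  qed
  show "(\<lambda>x. f x * (1 - g x)) \<in> ?F" if "f \<in> ?F" "g \<in> ?F" for f g
  proof -
    have "uniformly_continuous_on UNIV (\<lambda>x. f x * (1 - g x))"
      using that
      by (intro uniformly_continuous_on_mult_bounded uniformly_continuous_on_diff
          uniformly_continuous_on_const bounded_range_unit_interval) auto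
    with that show ?thesis by (auto simp: mult_le_one)
  qed
  show "f \<in> borel_measurable borel" "0 \<le> f x" "f x \<le> 1" if "f \<in> ?F" for f x
    using that by (auto intro!: borel_measurable_continuous_onI uniformly_continuous_imp_continuous)
qed

section \<open>Joint laws, products of marginals and covariances\<close>

text \<open>The covariance of the random variables \<open>p \<circ> \<xi>\<close> and \<open>q \<circ> \<eta>\<close>.\<close>

definition covariance ::
  "'c measure \<Rightarrow> ('c \<Rightarrow> 'a) \<Rightarrow> ('c \<Rightarrow> 'b) \<Rightarrow> ('a \<Rightarrow> real) \<Rightarrow> ('b \<Rightarrow> real) \<Rightarrow> real" where
  "covariance M \<xi> \<eta> p q =
     (LINT \<omega>|M. p (\<xi> \<omega>) * q (\<eta> \<omega>)) - (LINT \<omega>|M. p (\<xi> \<omega>)) * (LINT \<omega>|M. q (\<eta> \<omega>))"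

lemma sets_joint_distr [measurable_cong]: "sets (joint_distr M \<xi> \<eta>) = sets (borel \<Otimes>\<^sub>M borel)"
  by (simp add: joint_distr_def)

lemma sets_prod_distr [measurable_cong]: "sets (prod_distr M \<xi> \<eta>) = sets (borel \<Otimes>\<^sub>M borel)"
  unfolding prod_distr_def by (rule sets_pair_measure_cong) simp_all

lemma space_joint_distr [simp]: "space (joint_distr M \<xi> \<eta>) = UNIV"
  by (simp add: joint_distr_def space_pair_measure)

lemma space_prod_distr [simp]: "space (prod_distr M \<xi> \<eta>) = UNIV"
  by (simp add: prod_distr_def space_pair_measure)

context
  fixes M :: "'c measure"
    and \<xi> :: "'c \<Rightarrow> 'a::polish_space" and \<eta> :: "'c \<Rightarrow> 'b::polish_space"
  assumes M: "prob_space M"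
    and \<xi> [measurable]: "\<xi> \<in> borel_measurable M" and \<eta> [measurable]: "\<eta> \<in> borel_measurable M"
begin

lemma prob_space_joint_distr: "prob_space (joint_distr M \<xi> \<eta>)"
  unfolding joint_distr_def by (intro prob_space.prob_space_distr[OF M]) measurable

lemma pair_prob_space_marginals: "pair_prob_space (distr M borel \<xi>) (distr M borel \<eta>)"
proof -
  interpret P: prob_space "distr M borel \<xi>" by (intro prob_space.prob_space_distr[OF M]) measurable
  interpret Q: prob_space "distr M borel \<eta>" by (intro prob_space.prob_space_distr[OF M]) measurable
  show ?thesis by unfold_locales
qed

lemma prob_space_prod_distr: "prob_space (prod_distr M \<xi> \<eta>)"
proof -
  interpret pair_prob_space "distr M borel \<xi>" "distr M borel \<eta>" by (rule pair_prob_space_marginals)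
  show ?thesis unfolding prod_distr_def by unfold_locales
qed

lemma measure_prod_distr_Times:
  assumes [measurable]: "A \<in> sets borel" "B \<in> sets borel"
  shows "measure (prod_distr M \<xi> \<eta>) (A \<times> B) = measure (distr M borel \<xi>) A * measure (distr M borel \<eta>) B"
proof -
  interpret pair_prob_space "distr M borel \<xi>" "distr M borel \<eta>" by (rule pair_prob_space_marginals)
  show ?thesis
    unfolding prod_distr_def by (simp add: measure_def M2.emeasure_pair_measure_Times enn2real_mult)
qed

lemma measure_joint_distr_Times:
  assumes [measurable]: "A \<in> sets borel" "B \<in> sets borel"
  shows "measure (joint_distr M \<xi> \<eta>) (A \<times> B) = measure M {\<omega> \<in> space M. \<xi> \<omega> \<in> A \<and> \<eta> \<omega> \<in> B}"
  unfolding joint_distr_def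
  by (subst measure_distr) (auto intro!: arg_cong[where f = "measure M"])

lemma measure_joint_distr_marginals:
  assumes [measurable]: "A \<in> sets borel" "B \<in> sets borel"
  shows "measure (joint_distr M \<xi> \<eta>) (A \<times> UNIV) = measure (distr M borel \<xi>) A"
    and "measure (joint_distr M \<xi> \<eta>) (UNIV \<times> B) = measure (distr M borel \<eta>) B"
  by (simp_all add: measure_joint_distr_Times measure_distr vimage_def Int_def conj_commute)

lemma measure_prod_distr_marginals:
  assumes [measurable]: "A \<in> sets borel" "B \<in> sets borel"
  shows "measure (prod_distr M \<xi> \<eta>) (A \<times> UNIV) = measure (distr M borel \<xi>) A"
    and "measure (prod_distr M \<xi> \<eta>) (UNIV \<times> B) = measure (distr M borel \<eta>) B"
  using prob_space.prob_space_distr[OF M \<xi>, THEN prob_space.prob_space]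
    prob_space.prob_space_distr[OF M \<eta>, THEN prob_space.prob_space]
  by (simp_all add: measure_prod_distr_Times)

lemma AI_gap_eq_measure_diff:
  assumes "A \<in> sets borel" "B \<in> sets borel"
  shows "AI_gap M \<xi> \<eta> A B =
    \<bar>measure (joint_distr M \<xi> \<eta>) (A \<times> B) - measure (prod_distr M \<xi> \<eta>) (A \<times> B)\<bar>"
  using assms by (simp add: AI_gap_def measure_prod_distr_Times)

lemma AI_gap_le_1:
  assumes "A \<in> sets borel" "B \<in> sets borel"
  shows "AI_gap M \<xi> \<eta> A B \<le> 1"
  unfolding AI_gap_eq_measure_diff[OF assms]
  using prob_space.prob_le_1[OF prob_space_joint_distr, of "A \<times> B"]
    prob_space.prob_le_1[OF prob_space_prod_distr, of "A \<times> B"]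
    measure_nonneg[of "joint_distr M \<xi> \<eta>" "A \<times> B"] measure_nonneg[of "prod_distr M \<xi> \<eta>" "A \<times> B"]
  by linarith

lemma AI_gap_eq_covariance:
  assumes [measurable]: "A \<in> sets borel" "B \<in> sets borel"
  shows "AI_gap M \<xi> \<eta> A B = \<bar>covariance M \<xi> \<eta> (indicator A) (indicator B)\<bar>"
proof -
  have "(LINT \<omega>|M. indicator A (\<xi> \<omega>) * indicator B (\<eta> \<omega>) :: real) =
      (LINT \<omega>|M. indicator {\<omega> \<in> space M. \<xi> \<omega> \<in> A \<and> \<eta> \<omega> \<in> B} \<omega>)"
    by (intro Bochner_Integration.integral_cong) (auto simp: indicator_def)
  moreover have "(LINT \<omega>|M. indicator A (\<xi> \<omega>) :: real) = measure (distr M borel \<xi>) A"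
    by (subst integral_distr[symmetric, of \<xi> M borel]) auto
  moreover have "(LINT \<omega>|M. indicator B (\<eta> \<omega>) :: real) = measure (distr M borel \<eta>) B"
    by (subst integral_distr[symmetric, of \<eta> M borel]) auto
  ultimately show ?thesis
    by (simp add: AI_gap_def covariance_def measure_joint_distr_Times Int_def conj_commute)
qed

lemma integral_joint_minus_prod_distr:
  fixes p :: "'a \<Rightarrow> real" and q :: "'b \<Rightarrow> real"
  assumes [measurable]: "p \<in> borel_measurable borel" "q \<in> borel_measurable borel"
    and p: "bounded (range p)" and q: "bounded (range q)"
  shows "(LINT z|joint_distr M \<xi> \<eta>. p (fst z) * q (snd z)) -
    (LINT z|prod_distr M \<xi> \<eta>. p (fst z) * q (snd z)) = covariance M \<xi> \<eta> p q"
proof -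
  interpret pair_prob_space "distr M borel \<xi>" "distr M borel \<eta>" by (rule pair_prob_space_marginals)
  obtain b c where b: "\<And>x. \<bar>p x\<bar> \<le> b" and c: "\<And>y. \<bar>q y\<bar> \<le> c"
    using p q by (auto simp: bounded_iff)
  have "\<bar>p x * q y\<bar> \<le> b * c" for x y
    using mult_mono[OF b[of x] c[of y]] b[of x] by (auto simp: abs_mult)
  then have "integrable (distr M borel \<xi> \<Otimes>\<^sub>M distr M borel \<eta>) (\<lambda>z. p (fst z) * q (snd z))"
    by (intro P.integrable_const_bound[of _ "b * c"]) auto
  from integral_fst'[OF this]
  have "(LINT z|prod_distr M \<xi> \<eta>. p (fst z) * q (snd z)) =
      (LINT x|distr M borel \<xi>. p x) * (LINT y|distr M borel \<eta>. q y)"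
    by (simp add: prod_distr_def)
  moreover have "(LINT z|joint_distr M \<xi> \<eta>. p (fst z) * q (snd z)) = (LINT \<omega>|M. p (\<xi> \<omega>) * q (\<eta> \<omega>))"
    unfolding joint_distr_def by (subst integral_distr) auto
  ultimately show ?thesis
    by (simp add: covariance_def integral_distr)
qed

end

section \<open>Total variation bounds the gap\<close>

lemma measure_diff_le_tv_norm_diff:
  assumes "finite_measure \<mu>" "finite_measure \<nu>" "sets \<mu> = sets \<nu>" and A: "A \<in> sets \<mu>"
  shows "\<bar>measure \<mu> A - measure \<nu> A\<bar> \<le> tv_norm_diff \<mu> \<nu>"
proof -
  \<comment> \<open>The cells of a partition are nonempty, so an empty piece is left out.\<close>
  define P where "P = {A, space \<mu> - A} - {{}}"
  have P: "P \<in> {P. finite P \<and> P \<subseteq> sets \<mu> \<and> partition_on (space \<mu>) P}"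
    using A sets.sets_into_space[OF A] by (auto simp: P_def partition_on_def disjoint_def)
  have "\<bar>measure \<mu> A - measure \<nu> A\<bar> \<le> (\<Sum>A\<in>P. \<bar>measure \<mu> A - measure \<nu> A\<bar>)"
  proof (cases "A = {}")
    case True
    then show ?thesis by (simp add: sum_nonneg)
  next
    case False
    then have "A \<in> P" by (simp add: P_def)
    then show ?thesis
      using P by (intro member_le_sum) auto
  qed
  also have "\<dots> \<le> tv_norm_diff \<mu> \<nu>"
    unfolding tv_norm_diff_def
    by (intro cSUP_upper P tv_norm_diff_bdd_above assms)
  finally show ?thesis .
qed

section \<open>Approximation by sums of products\<close>

text \<open>
  If \<open>h\<close> and \<open>H\<close> are bounded by \<open>b\<close> and differ by at most \<open>e\<close> on \<open>K \<times> L\<close>, their integrals differ by at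
  most \<open>e\<close> plus \<open>2 * b\<close> times the mass outside \<open>K \<times> L\<close>.
\<close>

lemma integral_diff_le_off_rectangle:
  fixes h H :: "'a::polish_space \<times> 'b::polish_space \<Rightarrow> real"
  assumes "prob_space \<mu>" and sets [measurable_cong]: "sets \<mu> = sets (borel \<Otimes>\<^sub>M borel)"
    and [measurable]: "h \<in> borel_measurable (borel \<Otimes>\<^sub>M borel)" "H \<in> borel_measurable (borel \<Otimes>\<^sub>M borel)"
    and [measurable]: "K \<in> sets borel" "L \<in> sets borel"
    and h: "\<And>z. \<bar>h z\<bar> \<le> b" and H: "\<And>z. \<bar>H z\<bar> \<le> b"
    and close: "\<And>x y. x \<in> K \<Longrightarrow> y \<in> L \<Longrightarrow> \<bar>h (x, y) - H (x, y)\<bar> \<le> e" and "0 \<le> e"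
  shows "\<bar>(LINT z|\<mu>. h z) - (LINT z|\<mu>. H z)\<bar> \<le>
    e + 2 * b * (measure \<mu> ((- K) \<times> UNIV) + measure \<mu> (UNIV \<times> (- L)))"
proof -
  interpret prob_space \<mu> by fact
  have b: "0 \<le> b" using h[of undefined] by linarith
  have [simp]: "space \<mu> = UNIV"
    using sets_eq_imp_space_eq[OF sets] by (simp add: space_pair_measure)
  have [measurable]: "(- K) \<times> UNIV \<in> sets \<mu>" "UNIV \<times> (- L) \<in> sets \<mu>"
    unfolding sets by measurable
  have int: "integrable \<mu> h" "integrable \<mu> H"
    using h H by (auto intro!: integrable_const_bound[of _ b])
  define G :: "'a \<times> 'b \<Rightarrow> real" where
    "G = (\<lambda>z. e + 2 * b * (indicator ((- K) \<times> UNIV) z + indicator (UNIV \<times> (- L)) z))"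
  have "\<bar>h z - H z\<bar> \<le> G z" for z
  proof (cases z)
    case (Pair x y)
    have "\<bar>h z - H z\<bar> \<le> 2 * b" using h[of z] H[of z] by linarith
    then show ?thesis
      using close[of x y] b \<open>0 \<le> e\<close> by (auto simp: Pair G_def indicator_def)
  qed
  moreover have "integrable \<mu> G"
    unfolding G_def by (auto intro!: Bochner_Integration.integrable_add integrable_mult_right
      integrable_real_indicator simp: emeasure_eq_measure)
  moreover have "\<bar>(LINT z|\<mu>. h z) - (LINT z|\<mu>. H z)\<bar> = \<bar>LINT z|\<mu>. h z - H z\<bar>"
    using int by simp
  moreover have "\<bar>LINT z|\<mu>. h z - H z\<bar> \<le> (LINT z|\<mu>. \<bar>h z - H z\<bar>)"
    by (rule integral_abs_bound)
  ultimately have "\<bar>(LINT z|\<mu>. h z) - (LINT z|\<mu>. H z)\<bar> \<le> (LINT z|\<mu>. G z)"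
    using int integral_mono[of \<mu> "\<lambda>z. \<bar>h z - H z\<bar>" G] by auto
  also have "(LINT z|\<mu>. G z) = e + 2 * b * (measure \<mu> ((- K) \<times> UNIV) + measure \<mu> (UNIV \<times> (- L)))"
  proof -
    have "integrable \<mu> (indicator ((- K) \<times> UNIV) :: _ \<Rightarrow> real)"
      "integrable \<mu> (indicator (UNIV \<times> (- L)) :: _ \<Rightarrow> real)"
      by (auto intro!: integrable_real_indicator simp: emeasure_eq_measure)
    then show ?thesis
      unfolding G_def using prob_space by simp
  qed
  finally show ?thesis .
qed

text \<open>A combination \<open>\<Sum>\<Sum> f c d * (p c * q d)\<close> with subprobability weights is bounded by the
  coefficients of nonzero weight.\<close>

lemma abs_sum_product_weights_le:
  fixes p :: "'i \<Rightarrow> real" and q :: "'j \<Rightarrow> real"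
  assumes "\<And>c. c \<in> C \<Longrightarrow> 0 \<le> p c" "\<And>d. d \<in> D \<Longrightarrow> 0 \<le> q d"
    and "(\<Sum>c\<in>C. p c) \<le> 1" "(\<Sum>d\<in>D. q d) \<le> 1" and "0 \<le> b"
    and f: "\<And>c d. c \<in> C \<Longrightarrow> d \<in> D \<Longrightarrow> p c \<noteq> 0 \<Longrightarrow> q d \<noteq> 0 \<Longrightarrow> \<bar>f c d\<bar> \<le> b"
  shows "\<bar>\<Sum>c\<in>C. \<Sum>d\<in>D. f c d * (p c * q d)\<bar> \<le> b"
proof -
  have "\<bar>\<Sum>c\<in>C. \<Sum>d\<in>D. f c d * (p c * q d)\<bar> \<le> (\<Sum>c\<in>C. \<Sum>d\<in>D. \<bar>f c d * (p c * q d)\<bar>)"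
    by (rule order_trans[OF sum_abs]) (intro sum_mono sum_abs)
  also have "\<dots> \<le> (\<Sum>c\<in>C. \<Sum>d\<in>D. b * (p c * q d))"
  proof (intro sum_mono)
    fix c d assume cd: "c \<in> C" "d \<in> D"
    show "\<bar>f c d * (p c * q d)\<bar> \<le> b * (p c * q d)"
    proof (cases "p c = 0 \<or> q d = 0")
      case False
      with f[OF cd] assms(1,2) cd show ?thesis
        by (auto simp: abs_mult intro!: mult_right_mono)
    qed auto
  qed
  also have "\<dots> = b * ((\<Sum>c\<in>C. p c) * (\<Sum>d\<in>D. q d))"
    by (simp only: sum_product) (simp only: sum_distrib_left)
  also have "\<dots> \<le> b * 1"
    using assms by (intro mult_left_mono mult_le_one sum_nonneg) auto
  finally show ?thesis by simp
qed

lemma compact_finite_ball_cover: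
  fixes K :: "'a::metric_space set"
  assumes "compact K" "0 < \<delta>"
  obtains C where "finite C" "K \<subseteq> (\<Union>c\<in>C. ball c \<delta>)"
  using assms unfolding compact_eq_totally_bounded by blast

theorem AI1_if_covariance_tendsto_0:
  fixes M :: "'c measure"
    and X :: "nat \<Rightarrow> 'c \<Rightarrow> 'a::polish_space"
    and Y :: "nat \<Rightarrow> 'c \<Rightarrow> 'b::polish_space"
  assumes M: "prob_space M"
    and X [measurable]: "\<And>n. X n \<in> borel_measurable M"
    and Y [measurable]: "\<And>n. Y n \<in> borel_measurable M"
    and tight_X: "tight_measures (\<lambda>n. distr M borel (X n))"
    and tight_Y: "tight_measures (\<lambda>n. distr M borel (Y n))"
    and F: "bump_class F" and G: "bump_class G"
    and cov: "\<And>f g. f \<in> F \<Longrightarrow> g \<in> G \<Longrightarrow> (\<lambda>n. covariance M (X n) (Y n) f g) \<longlonglongrightarrow> 0"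
  shows "AI1 M X Y"
  unfolding AI1_def
proof (intro allI impI, elim conjE)
  fix h :: "'a \<times> 'b \<Rightarrow> real"
  assume "bounded (range h)" and h_unif: "uniformly_continuous_sum h"
  then obtain b where b: "0 < b" and h_le: "\<And>z. \<bar>h z\<bar> \<le> b"
    by (auto simp: bounded_pos)
  have "continuous_on UNIV h"
    using h_unif by (simp add: uniformly_continuous_sum_iff uniformly_continuous_imp_continuous)
  then have h_meas [measurable]: "h \<in> borel_measurable (borel \<Otimes>\<^sub>M borel)"
    by (simp add: borel_prod borel_measurable_continuous_onI)
  let ?J = "\<lambda>n. joint_distr M (X n) (Y n)" and ?P = "\<lambda>n. prod_distr M (X n) (Y n)"
  show "(\<lambda>n. (LINT z|?J n. h z) - (LINT z|?P n. h z)) \<longlonglongrightarrow> 0"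
  proof (rule LIMSEQ_I)
    fix r :: real assume r: "0 < r"
    \<comment> \<open>With \<open>e\<close> for the approximation on \<open>K \<times> L\<close> and \<open>s\<close> for the tails, each of the two replacements
      of \<open>h\<close> by \<open>H\<close> costs at most \<open>e + 2 * b * (s + s) = 3 * r / 8\<close>.\<close>
    define e where "e = r / 8"
    define s where "s = r / (16 * b)"
    have es: "0 < e" "0 < s" using r b by (auto simp: e_def s_def)
    obtain K where K: "compact K" "\<And>n. measure (distr M borel (X n)) (- K) < s"
      using tight_X es unfolding tight_measures_def by blast
    obtain L where L: "compact L" "\<And>n. measure (distr M borel (Y n)) (- L) < s"
      using tight_Y es unfolding tight_measures_def by blast
    have KL: "K \<in> sets borel" "L \<in> sets borel"
      using K(1) L(1) by (auto intro: borel_compact)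
    then have KL': "- K \<in> sets borel" "- L \<in> sets borel"
      by (auto intro: borel_comp)
    obtain \<delta>' where \<delta>': "0 < \<delta>'" "\<And>z w. sum_dist z w < \<delta>' \<Longrightarrow> \<bar>h z - h w\<bar> < e"
      using h_unif es unfolding uniformly_continuous_sum_def by blast
    \<comment> \<open>The weights live on balls of radius \<open>2 * \<delta>\<close>, in two coordinates whose distances add up.\<close>
    define \<delta> where "\<delta> = \<delta>' / 4"
    have \<delta>: "0 < \<delta>" using \<delta>' by (simp add: \<delta>_def)
    obtain C where C: "finite C" "K \<subseteq> (\<Union>c\<in>C. ball c \<delta>)"
      using compact_finite_ball_cover[OF K(1) \<delta>] .
    obtain D where D: "finite D" "L \<subseteq> (\<Union>d\<in>D. ball d \<delta>)"
      using compact_finite_ball_cover[OF L(1) \<delta>] .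
    obtain p where p: "\<And>c. c \<in> C \<Longrightarrow> p c \<in> F" "\<And>x. (\<Sum>c\<in>C. p c x) \<le> 1"
      "\<And>x. x \<in> (\<Union>c\<in>C. ball c \<delta>) \<Longrightarrow> (\<Sum>c\<in>C. p c x) = 1"
      "\<And>c x. c \<in> C \<Longrightarrow> p c x \<noteq> 0 \<Longrightarrow> dist c x < 2 * \<delta>"
      by (rule bump_class_weights[OF F \<delta> C(1)]) (rule that)
    obtain q where q: "\<And>d. d \<in> D \<Longrightarrow> q d \<in> G" "\<And>y. (\<Sum>d\<in>D. q d y) \<le> 1"
      "\<And>y. y \<in> (\<Union>d\<in>D. ball d \<delta>) \<Longrightarrow> (\<Sum>d\<in>D. q d y) = 1"
      "\<And>d y. d \<in> D \<Longrightarrow> q d y \<noteq> 0 \<Longrightarrow> dist d y < 2 * \<delta>"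
      by (rule bump_class_weights[OF G \<delta> D(1)]) (rule that)
    have p01: "p c \<in> borel_measurable borel" "0 \<le> p c x" "p c x \<le> 1" if "c \<in> C" for c x
      using p(1)[OF that] by (auto intro: bump_class_measurable bump_class_nonneg bump_class_le_1 F)
    have q01: "q d \<in> borel_measurable borel" "0 \<le> q d y" "q d y \<le> 1" if "d \<in> D" for d y
      using q(1)[OF that] by (auto intro: bump_class_measurable bump_class_nonneg bump_class_le_1 G)
    define H where "H = (\<lambda>z. \<Sum>c\<in>C. \<Sum>d\<in>D. h (c, d) * (p c (fst z) * q d (snd z)))"
    have pq_meas: "(\<lambda>z. p c (fst z) * q d (snd z)) \<in> borel_measurable (borel \<Otimes>\<^sub>M borel)"
      if "c \<in> C" "d \<in> D" for c d
      using p01(1)[OF that(1)] q01(1)[OF that(2)] by measurable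
    have H_meas: "H \<in> borel_measurable (borel \<Otimes>\<^sub>M borel)"
      unfolding H_def by (intro borel_measurable_sum borel_measurable_times borel_measurable_const pq_meas)
    have H_le: "\<bar>H z\<bar> \<le> b" for z
      unfolding H_def using b h_le p01 q01 p(2) q(2) by (intro abs_sum_product_weights_le) auto
    have close: "\<bar>h (x, y) - H (x, y)\<bar> \<le> e" if "x \<in> K" "y \<in> L" for x y
    proof -
      have "(\<Sum>c\<in>C. p c x) * (\<Sum>d\<in>D. q d y) = 1"
        using p(3)[of x] q(3)[of y] that C(2) D(2) by (simp add: subset_iff)
      then have "(\<Sum>c\<in>C. \<Sum>d\<in>D. p c x * q d y) = 1"
        by (simp add: sum_product)
      then have "h (x, y) = (\<Sum>c\<in>C. \<Sum>d\<in>D. h (x, y) * (p c x * q d y))"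
        by (simp flip: sum_distrib_left)
      then have "h (x, y) - H (x, y) = (\<Sum>c\<in>C. \<Sum>d\<in>D. (h (x, y) - h (c, d)) * (p c x * q d y))"
        by (simp add: H_def sum_subtractf left_diff_distrib)
      moreover have "\<bar>h (x, y) - h (c, d)\<bar> \<le> e"
        if "c \<in> C" "d \<in> D" "p c x \<noteq> 0" "q d y \<noteq> 0" for c d
      proof -
        have "sum_dist (x, y) (c, d) < \<delta>'"
          using p(4)[OF that(1,3)] q(4)[OF that(2,4)]
          by (simp add: sum_dist_def \<delta>_def dist_commute)
        then show ?thesis using \<delta>'(2) by fastforce
      qed
      ultimately show ?thesis
        using es p01 q01 p(2) q(2) by (simp add: abs_sum_product_weights_le)
    qed
    have J_err: "\<bar>(LINT z|?J n. h z) - (LINT z|?J n. H z)\<bar> \<le> 3 * r / 8"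
      and P_err: "\<bar>(LINT z|?P n. h z) - (LINT z|?P n. H z)\<bar> \<le> 3 * r / 8" for n
    proof -
      have tails: "measure (distr M borel (X n)) (- K) + measure (distr M borel (Y n)) (- L) \<le> 2 * s"
        using K(2)[of n] L(2)[of n] by simp
      have bound: "e + 2 * b * (measure (distr M borel (X n)) (- K) + measure (distr M borel (Y n)) (- L))
          \<le> 3 * r / 8"
        using mult_left_mono[OF tails, of "2 * b"] b by (simp add: e_def s_def)
      have "\<bar>(LINT z|?J n. h z) - (LINT z|?J n. H z)\<bar> \<le>
          e + 2 * b * (measure (?J n) ((- K) \<times> UNIV) + measure (?J n) (UNIV \<times> (- L)))"
        using es close h_le H_le h_meas H_meas KL
        by (intro integral_diff_le_off_rectangle prob_space_joint_distr M X Y sets_joint_distr) auto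
      with bound show "\<bar>(LINT z|?J n. h z) - (LINT z|?J n. H z)\<bar> \<le> 3 * r / 8"
        by (simp only: measure_joint_distr_marginals[OF M X Y KL'])
      have "\<bar>(LINT z|?P n. h z) - (LINT z|?P n. H z)\<bar> \<le>
          e + 2 * b * (measure (?P n) ((- K) \<times> UNIV) + measure (?P n) (UNIV \<times> (- L)))"
        using es close h_le H_le h_meas H_meas KL
        by (intro integral_diff_le_off_rectangle prob_space_prod_distr M X Y sets_prod_distr) auto
      with bound show "\<bar>(LINT z|?P n. h z) - (LINT z|?P n. H z)\<bar> \<le> 3 * r / 8"
        by (simp only: measure_prod_distr_marginals[OF M X Y KL'])
    qed
    have H_diff: "(LINT z|?J n. H z) - (LINT z|?P n. H z) =
        (\<Sum>c\<in>C. \<Sum>d\<in>D. h (c, d) * covariance M (X n) (Y n) (p c) (q d))" for n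
    proof -
      have LINT_H: "(LINT z|\<mu>. H z) =
          (\<Sum>c\<in>C. \<Sum>d\<in>D. h (c, d) * (LINT z|\<mu>. p c (fst z) * q d (snd z)))"
        if "prob_space \<mu>" "sets \<mu> = sets (borel \<Otimes>\<^sub>M borel)" for \<mu>
      proof -
        interpret prob_space \<mu> by fact
        have "integrable \<mu> (\<lambda>z. p c (fst z) * q d (snd z))" if "c \<in> C" "d \<in> D" for c d
        proof (rule integrable_const_bound[of _ 1])
          show "(\<lambda>z. p c (fst z) * q d (snd z)) \<in> borel_measurable \<mu>"
            using pq_meas[OF that] measurable_cong_sets[OF \<open>sets \<mu> = _\<close> refl] by blast
          show "AE z in \<mu>. norm (p c (fst z) * q d (snd z)) \<le> 1"
            using p01[OF that(1)] q01[OF that(2)] by (auto simp: abs_mult intro!: mult_le_one)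
        qed
        then show ?thesis
          unfolding H_def by (simp add: Bochner_Integration.integral_sum)
      qed
      have "(LINT z|?J n. p c (fst z) * q d (snd z)) - (LINT z|?P n. p c (fst z) * q d (snd z)) =
          covariance M (X n) (Y n) (p c) (q d)" if "c \<in> C" "d \<in> D" for c d
        using p01[OF that(1)] q01[OF that(2)]
        by (intro integral_joint_minus_prod_distr M X Y bounded_range_unit_interval)
      then show ?thesis
        by (simp add: LINT_H prob_space_joint_distr prob_space_prod_distr M X Y
            sets_joint_distr sets_prod_distr flip: sum_subtractf right_diff_distrib)
    qed
    have "(\<lambda>n. (LINT z|?J n. H z) - (LINT z|?P n. H z)) \<longlonglongrightarrow> 0"
      unfolding H_diff
      by (intro tendsto_null_sum tendsto_mult_right_zero cov p(1) q(1))
    from LIMSEQ_D[OF this, of "r / 8"] r obtain N where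
      N: "\<And>n. n \<ge> N \<Longrightarrow> \<bar>(LINT z|?J n. H z) - (LINT z|?P n. H z)\<bar> < r / 8"
      by auto
    have "norm ((LINT z|?J n. h z) - (LINT z|?P n. h z) - 0) < r" if "n \<ge> N" for n
      using N[OF that] J_err[of n] P_err[of n] r
      unfolding real_norm_def diff_0_right by linarith
    then show "\<exists>N. \<forall>n\<ge>N. norm ((LINT z|?J n. h z) - (LINT z|?P n. h z) - 0) < r"
      by blast
  qed
qed

section \<open>The implications\<close>

theorem proposition5:
  fixes M :: "'c measure"
    and X :: "nat \<Rightarrow> 'c \<Rightarrow> 'a::polish_space"
    and Y :: "nat \<Rightarrow> 'c \<Rightarrow> 'b::polish_space"
  assumes "prob_space M"
    and "\<And>n. X n \<in> borel_measurable M"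
    and "\<And>n. Y n \<in> borel_measurable M"
    and "tight_measures (\<lambda>n. distr M borel (X n))"
    and "tight_measures (\<lambda>n. distr M borel (Y n))"
  shows "(AI4 M X Y \<longrightarrow> AI3 M X Y) \<and> (AI3 M X Y \<longrightarrow> AI2 M X Y) \<and>
         (AI2 M X Y \<longrightarrow> AI1 M X Y) \<and> (AI1 M X Y \<longrightarrow> AI0 M X Y) \<and>
         (AI0 M X Y \<longrightarrow> AI1 M X Y)"
proof (intro conjI impI)
  note gap_eq = AI_gap_eq_measure_diff[OF assms(1-3)]
  have gap_nonneg: "0 \<le> AI_gap M (X n) (Y n) A B" for n A B
    by (simp add: AI_gap_def)
  let ?S = "\<lambda>n. SUP (A, B) \<in> sets borel \<times> sets borel. AI_gap M (X n) (Y n) A B"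
  have gap_le_S: "AI_gap M (X n) (Y n) A B \<le> ?S n" if "A \<in> sets borel" "B \<in> sets borel" for n A B
  proof -
    have "bdd_above ((\<lambda>(A, B). AI_gap M (X n) (Y n) A B) ` (sets borel \<times> sets borel))"
      using AI_gap_le_1[OF assms(1-3)] by (intro bdd_aboveI2[of _ _ 1]) auto
    from cSUP_upper[OF _ this, of "(A, B)"] that show ?thesis by simp
  qed
  show "AI3 M X Y" if "AI4 M X Y"
    unfolding AI3_def
  proof (rule tendsto_sandwich[where f = "\<lambda>_. 0"
        and h = "\<lambda>n. tv_norm_diff (joint_distr M (X n) (Y n)) (prod_distr M (X n) (Y n))"])
    show "(\<lambda>n. tv_norm_diff (joint_distr M (X n) (Y n)) (prod_distr M (X n) (Y n))) \<longlonglongrightarrow> 0"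
      using that by (simp add: AI4_def)
    show "\<forall>\<^sub>F n in sequentially. 0 \<le> ?S n"
      using order_trans[OF gap_nonneg gap_le_S, of "{}" "{}"] by (intro always_eventually) simp
    show "\<forall>\<^sub>F n in sequentially.
        ?S n \<le> tv_norm_diff (joint_distr M (X n) (Y n)) (prod_distr M (X n) (Y n))"
    proof (intro always_eventually allI cSUP_least)
      fix n and AB :: "'a set \<times> 'b set" assume "AB \<in> sets borel \<times> sets borel"
      then obtain A B where AB: "AB = (A, B)" "A \<in> sets borel" "B \<in> sets borel" by auto
      then have "AI_gap M (X n) (Y n) A B
          \<le> tv_norm_diff (joint_distr M (X n) (Y n)) (prod_distr M (X n) (Y n))"
        unfolding gap_eq[OF AB(2,3)]
        using prob_space_joint_distr[OF assms(1-3)] prob_space_prod_distr[OF assms(1-3)]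
        by (intro measure_diff_le_tv_norm_diff)
          (auto simp: sets_joint_distr sets_prod_distr prob_space.finite_measure)
      then show "(case AB of (A, B) \<Rightarrow> AI_gap M (X n) (Y n) A B)
          \<le> tv_norm_diff (joint_distr M (X n) (Y n)) (prod_distr M (X n) (Y n))"
        by (simp add: AB)
    qed auto
  qed simp
  show "AI2 M X Y" if "AI3 M X Y"
    unfolding AI2_def
  proof (intro ballI)
    fix A :: "'a set" and B :: "'b set" assume AB: "A \<in> sets borel" "B \<in> sets borel"
    show "(\<lambda>n. AI_gap M (X n) (Y n) A B) \<longlonglongrightarrow> 0"
    proof (rule tendsto_sandwich[where f = "\<lambda>_. 0" and h = ?S])
      show "\<forall>\<^sub>F n in sequentially. 0 \<le> AI_gap M (X n) (Y n) A B"
        by (rule always_eventually, rule allI, rule gap_nonneg)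
      show "\<forall>\<^sub>F n in sequentially. AI_gap M (X n) (Y n) A B \<le> ?S n"
        by (rule always_eventually, rule allI, rule gap_le_S[OF AB])
      show "?S \<longlonglongrightarrow> 0"
        using that by (simp only: AI3_def)
    qed (rule tendsto_const)
  qed
  show "AI1 M X Y" if "AI2 M X Y"
  proof (rule AI1_if_covariance_tendsto_0[OF assms bump_class_indicator bump_class_indicator])
    fix f :: "'a \<Rightarrow> real" and g :: "'b \<Rightarrow> real"
    assume "f \<in> {indicator A | A. A \<in> sets borel}" "g \<in> {indicator A | A. A \<in> sets borel}"
    then obtain A B where AB: "f = indicator A" "g = indicator B" "A \<in> sets borel" "B \<in> sets borel"
      by blast
    then have "(\<lambda>n. \<bar>covariance M (X n) (Y n) f g\<bar>) \<longlonglongrightarrow> 0"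
      using that by (simp add: AI2_def flip: AI_gap_eq_covariance[OF assms(1-3)])
    then show "(\<lambda>n. covariance M (X n) (Y n) f g) \<longlonglongrightarrow> 0"
      by (rule tendsto_rabs_zero_cancel)
  qed
  show "AI1 M X Y" if "AI0 M X Y"
  proof (rule AI1_if_covariance_tendsto_0[OF assms
        bump_class_uniformly_continuous bump_class_uniformly_continuous])
    fix f :: "'a \<Rightarrow> real" and g :: "'b \<Rightarrow> real"
    assume "f \<in> {f. uniformly_continuous_on UNIV f \<and> (\<forall>x. 0 \<le> f x \<and> f x \<le> 1)}"
      "g \<in> {g. uniformly_continuous_on UNIV g \<and> (\<forall>x. 0 \<le> g x \<and> g x \<le> 1)}"
    with that show "(\<lambda>n. covariance M (X n) (Y n) f g) \<longlonglongrightarrow> 0"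
      unfolding covariance_def AI0_def by (simp add: bounded_range_unit_interval)
  qed
  show "AI0 M X Y" if "AI1 M X Y"
    unfolding AI0_def
  proof (intro allI impI, elim conjE)
    fix f :: "'a \<Rightarrow> real" and g :: "'b \<Rightarrow> real"
    assume f: "bounded (range f)" "uniformly_continuous_on UNIV f"
      and g: "bounded (range g)" "uniformly_continuous_on UNIV g"
    let ?h = "\<lambda>z. f (fst z) * g (snd z)"
    have bdd: "bounded (range (\<lambda>z::'a \<times> 'b. f (fst z)))" "bounded (range (\<lambda>z::'a \<times> 'b. g (snd z)))"
      using f(1) g(1) by (auto intro: bounded_subset)
    have "uniformly_continuous_on UNIV (fst :: 'a \<times> 'b \<Rightarrow> 'a)" "uniformly_continuous_on UNIV (snd :: 'a \<times> 'b \<Rightarrow> 'b)"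
      by (intro lipschitz_on_uniformly_continuous[of 1] lipschitz_onI; simp add: dist_fst_le dist_snd_le)+
    then have unif: "uniformly_continuous_on UNIV (\<lambda>z::'a \<times> 'b. f (fst z))"
      "uniformly_continuous_on UNIV (\<lambda>z::'a \<times> 'b. g (snd z))"
      using uniformly_continuous_on_compose[of UNIV fst f]
        uniformly_continuous_on_compose[of UNIV snd g] f(2) g(2)
      by (auto simp: o_def)
    obtain a b where ab: "\<And>x. \<bar>f x\<bar> \<le> a" "\<And>y. \<bar>g y\<bar> \<le> b"
      using f(1) g(1) by (auto simp: bounded_iff)
    have "\<bar>f x * g y\<bar> \<le> a * b" for x y
      using mult_mono[OF ab(1)[of x] ab(2)[of y]] ab(1)[of x] by (auto simp: abs_mult)
    then have "bounded (range ?h)"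
      by (intro boundedI[of _ "a * b"]) auto
    moreover have "uniformly_continuous_sum ?h"
      unfolding uniformly_continuous_sum_iff
      by (intro uniformly_continuous_on_mult_bounded unif bdd)
    ultimately have "(\<lambda>n. (LINT z|joint_distr M (X n) (Y n). ?h z)
        - (LINT z|prod_distr M (X n) (Y n). ?h z)) \<longlonglongrightarrow> 0"
      using that unfolding AI1_def by blast
    moreover have "f \<in> borel_measurable borel" "g \<in> borel_measurable borel"
      using f(2) g(2) by (auto intro: borel_measurable_continuous_onI uniformly_continuous_imp_continuous)
    ultimately show "(\<lambda>n. (LINT \<omega>|M. f (X n \<omega>) * g (Y n \<omega>))
        - (LINT \<omega>|M. f (X n \<omega>)) * (LINT \<omega>|M. g (Y n \<omega>))) \<longlonglongrightarrow> 0"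
      using f(1) g(1)
      by (simp add: integral_joint_minus_prod_distr[OF assms(1-3)] flip: covariance_def)
  qed
qed

end
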